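(* Let $(X,\preceq)$ be a partial order that has a countable multi-utility, and let $x,y \in X$ be incomparable, $x \bowtie y$. Then there exists a sequence $(\preceq_n)_{n \geq 0}$ of extensions of $\preceq$ such that $\preceq' := \lim_{n \to \infty} \preceq_n$ is a Debreu separable extension of $\preceq$ with $x \preceq' y$.
   Context: For a partial order $(X,\preceq)$: $x \prec y$ means $x \preceq y$ and not $y \preceq x$; $x \bowtie y$ means neither $x \preceq y$ nor $y \preceq x$. A multi-utility of $(X,\preceq)$ is a family $(u_i)_{i\in I}$ of functions $u_i:X\to\mathbb{R}$ such that for all $x,y\in X$, $x \preceq y$ iff $u_i(x)\le u_i(y)$ for all $i\in I$; it is countable if $I$ is countable. An extension of $\preceq$ is a partial order $\preceq'$ on $X$ with $x\preceq y\Rightarrow x\preceq' y$. A partial order $\preceq'$ is Debreu separable if there is a countable $D\subseteq X$ such that whenever $x\prec' y$ there is $d\in D$ with $x\preceq' d\preceq' y$. For a sequence $(\preceq_n)_{n\ge0}$ of binary relations on $X$, $\lim_{n\to\infty}\preceq_n$ is the relation with $x$ related to $y$ iff there is $n_0\ge0$ such that $x\preceq_n y$ for all $n\ge n_0$. *)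

theory Defs
  imports Complex_Main "HOL-Library.Countable_Set"
begin

definition strictly_below :: "'a rel \<Rightarrow> 'a \<Rightarrow> 'a \<Rightarrow> bool" where
  "strictly_below r x y \<longleftrightarrow> (x, y) \<in> r \<and> (y, x) \<notin> r"

definition incomparable :: "'a rel \<Rightarrow> 'a \<Rightarrow> 'a \<Rightarrow> bool" where
  "incomparable r x y \<longleftrightarrow> (x, y) \<notin> r \<and> (y, x) \<notin> r"

definition multi_utility ::
  "'a set \<Rightarrow> 'a rel \<Rightarrow> 'i set \<Rightarrow> ('i \<Rightarrow> 'a \<Rightarrow> real) \<Rightarrow> bool" where
  "multi_utility X r I u \<longleftrightarrow>
     (\<forall>x\<in>X. \<forall>y\<in>X. (x, y) \<in> r \<longleftrightarrow> (\<forall>i\<in>I. u i x \<le> u i y))"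

definition is_extension :: "'a set \<Rightarrow> 'a rel \<Rightarrow> 'a rel \<Rightarrow> bool" where
  "is_extension X r r' \<longleftrightarrow> partial_order_on X r' \<and> r \<subseteq> r'"

definition debreu_separable :: "'a set \<Rightarrow> 'a rel \<Rightarrow> bool" where
  "debreu_separable X r \<longleftrightarrow>
     (\<exists>D. D \<subseteq> X \<and> countable D \<and>
        (\<forall>x\<in>X. \<forall>y\<in>X. strictly_below r x y \<longrightarrow>
           (\<exists>d\<in>D. (x, d) \<in> r \<and> (d, y) \<in> r)))"

definition lim_rel :: "(nat \<Rightarrow> 'a rel) \<Rightarrow> 'a rel" where
  "lim_rel R = {(x, y). \<exists>n\<^sub>0. \<forall>n\<ge>n\<^sub>0. (x, y) \<in> R n}"

end

theory Submission
  imports Defs "HOL-Library.Indicator_Function"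
begin

text \<open>
  The sets \<open>{z. q < u i z}\<close> with \<open>q\<close> rational form a countable family \<open>A\<close> of up-sets, and
  \<open>a\<close> lies below \<open>b\<close> iff every member of the family containing \<open>a\<close> contains \<open>b\<close>. Reading the
  indicators of \<open>A 0, A 1, \<dots>\<close> as ternary digits maps \<open>X\<close> injectively and monotonically into the
  reals, so it induces a linear, Debreu separable extension. If \<open>A 0\<close> is chosen to contain \<open>y\<close>
  but not \<open>x\<close>, the leading digit puts \<open>x\<close> below \<open>y\<close>. The constant sequence at this extension
  has the required limit.
\<close>

definition ternary_code :: "(nat \<Rightarrow> 'a set) \<Rightarrow> 'a \<Rightarrow> real" where
  "ternary_code A z = (\<Sum>k. indicator (A k) z * (1/3)^k)"

lemma summable_ternary: "summable (\<lambda>k. indicator (A k) z * (1/3::real)^k)"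
  by (rule summable_comparison_test'[where g="\<lambda>k. (1/3::real)^k" and N=0])
     (auto simp: indicator_def)

lemma ternary_code_mono:
  assumes "\<And>k. a \<in> A k \<Longrightarrow> b \<in> A k"
  shows "ternary_code A a \<le> ternary_code A b"
  unfolding ternary_code_def
  by (intro suminf_le summable_ternary) (use assms in \<open>auto simp: indicator_def\<close>)

text \<open>The first differing digit decides: all later digits of \<open>a\<close> together
  contribute at most half of \<open>(1/3)^n\<close>. In base 2 this tail could equal the digit
  itself, and strictness would fail.\<close>

lemma ternary_code_less:
  assumes "\<And>m. m < n \<Longrightarrow> a \<in> A m \<longleftrightarrow> b \<in> A m" and "a \<notin> A n" and "b \<in> A n"
  shows "ternary_code A a < ternary_code A b"
proof -
  define d where "d z k = indicator (A k) z * (1/3::real)^k" for z k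
  have d: "summable (d z)" "ternary_code A z = (\<Sum>k. d z (k + Suc n)) + (\<Sum>k<Suc n. d z k)" for z
    using summable_ternary[of A z] suminf_split_initial_segment[of "d z" "Suc n"]
    by (simp_all add: ternary_code_def d_def[abs_def])
  have init: "(\<Sum>k<Suc n. d b k) = (\<Sum>k<Suc n. d a k) + (1/3)^n"
  proof -
    have "(\<Sum>k<n. d b k) = (\<Sum>k<n. d a k)"
      using assms(1) by (intro sum.cong) (auto simp: d_def indicator_def)
    with assms(2,3) show ?thesis
      by (simp add: d_def)
  qed
  have "(\<lambda>k. (1/3)^Suc n * (1/3::real)^k) sums ((1/3)^Suc n * (1 / (1 - 1/3)))"
    by (intro sums_mult geometric_sums) simp
  then have tail: "(\<lambda>k. (1/3::real)^(k + Suc n)) sums ((1/3)^n / 2)"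
    by (simp add: power_add mult_ac)
  have "(\<Sum>k. d a (k + Suc n)) \<le> (\<Sum>k. (1/3)^(k + Suc n))"
    using summable_ignore_initial_segment[OF d(1), of a "Suc n"] sums_summable[OF tail]
    by (intro suminf_le) (auto simp: d_def indicator_def)
  also have "\<dots> = (1/3)^n / 2"
    using tail by (rule sums_unique[symmetric])
  also have "\<dots> < (1/3)^n"
    by simp
  finally have upper: "(\<Sum>k. d a (k + Suc n)) < (1/3)^n" .
  have "0 \<le> (\<Sum>k. d b (k + Suc n))"
    using summable_ignore_initial_segment[OF d(1), of b "Suc n"]
    by (intro suminf_nonneg) (auto simp: d_def)
  with upper init show ?thesis
    by (simp add: d(2))
qed

text \<open>At the least index where the digits differ, \<open>ternary_code_less\<close> would make
  the codes different.\<close>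

lemma ternary_code_inject:
  assumes "ternary_code A a = ternary_code A b"
  shows "a \<in> A k \<longleftrightarrow> b \<in> A k"
proof (induction k rule: less_induct)
  case (less k)
  then show ?case
    using assms ternary_code_less[of k a A b] ternary_code_less[of k b A a] by fastforce
qed

text \<open>Points chosen from rational windows separate \<open>f a\<close> from \<open>f b\<close>
  when some value lies strictly between. Jumps of \<open>f\<close> require the second kind of point,
  one attaining the lower edge.\<close>

lemma debreu_separable_utility:
  fixes f :: "'a \<Rightarrow> real"
  shows "debreu_separable X {(a, b). a \<in> X \<and> b \<in> X \<and> f a \<le> f b}"
proof -
  define between where "between p q z \<longleftrightarrow> z \<in> X \<and> p < f z \<and> f z < q" for p q z
  define greatest where
    "greatest q z \<longleftrightarrow> z \<in> X \<and> f z \<le> q \<and> (\<forall>w\<in>X. f w \<le> q \<longrightarrow> f w \<le> f z)" for q z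
  \<comment> \<open>\<open>SOME\<close> is arbitrary where no point qualifies; intersecting with
    \<open>X\<close> removes any such value outside \<open>X\<close>.\<close>
  define D where "D = X \<inter> ((\<lambda>(p, q). SOME z. between p q z) ` (\<rat> \<times> \<rat>)
    \<union> (\<lambda>q. SOME z. greatest q z) ` \<rat>)"
  have "countable D"
    unfolding D_def by (intro countable_Int2 countable_Un countable_image countable_SIGMA countable_rat)
  moreover have "\<exists>d\<in>D. f a \<le> f d \<and> f d \<le> f b" if "a \<in> X" "b \<in> X" "f a < f b" for a b
  proof (cases "\<exists>c\<in>X. f a < f c \<and> f c < f b")
    case True
    then obtain c where c: "c \<in> X" "f a < f c" "f c < f b"
      by blast
    obtain p where p: "p \<in> \<rat>" "f a < p" "p < f c"
      using Rats_dense_in_real c(2) by blast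
    obtain q where q: "q \<in> \<rat>" "f c < q" "q < f b"
      using Rats_dense_in_real c(3) by blast
    from c p q have "between p q (SOME z. between p q z)"
      by (intro someI[of "between p q" c]) (simp add: between_def)
    with p q show ?thesis
      by (intro bexI[of _ "SOME z. between p q z"]) (auto simp: between_def D_def)
  next
    \<comment> \<open>\<open>f a\<close> and \<open>f b\<close> bound a gap of \<open>f ` X\<close>, which a rational in it identifies.\<close>
    case False
    obtain q where q: "q \<in> \<rat>" "f a < q" "q < f b"
      using Rats_dense_in_real \<open>f a < f b\<close> by blast
    have "greatest q a"
      using False q that by (force simp: greatest_def)
    moreover from this have "greatest q (SOME z. greatest q z)"
      by (rule someI)
    \<comment> \<open>Two greatest points for the same \<open>q\<close> have equal values, so the
      chosen point has value \<open>f a\<close>.\<close>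
    ultimately show ?thesis
      using q that
      by (intro bexI[of _ "SOME z. greatest q z"]) (auto simp: greatest_def D_def)
  qed
  moreover have "D \<subseteq> X"
    by (simp add: D_def)
  ultimately show ?thesis
    unfolding debreu_separable_def strictly_below_def
    by (intro exI[of _ D] conjI ballI impI) (simp_all add: not_le, blast)
qed

lemma partial_order_on_injective_utility:
  fixes f :: "'a \<Rightarrow> real"
  assumes "inj_on f X"
  shows "partial_order_on X {(a, b). a \<in> X \<and> b \<in> X \<and> f a \<le> f b}"
  using assms
  by (auto simp: partial_order_on_def preorder_on_def refl_on_def trans_def antisym_def inj_on_def)

lemma lim_rel_const: "lim_rel (\<lambda>_. s) = s"
  by (auto simp: lim_rel_def)

theorem theorem1:
  fixes X :: "'a set" and r :: "'a rel"
    and I :: "'i set" and u :: "'i \<Rightarrow> 'a \<Rightarrow> real"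
    and x y :: 'a
  assumes "partial_order_on X r"
    and "countable I" and "multi_utility X r I u"
    and "x \<in> X" and "y \<in> X" and "incomparable r x y"
  shows "\<exists>R :: nat \<Rightarrow> 'a rel.
           (\<forall>n. is_extension X r (R n)) \<and>
           is_extension X r (lim_rel R) \<and>
           debreu_separable X (lim_rel R) \<and>
           (x, y) \<in> lim_rel R"
proof -
  have mu: "(a, b) \<in> r \<longleftrightarrow> (\<forall>i\<in>I. u i a \<le> u i b)" if "a \<in> X" "b \<in> X" for a b
    using assms(3) that by (auto simp: multi_utility_def)
  have r_sub: "r \<subseteq> X \<times> X" and "antisym r"
    using assms(1) by (auto simp: partial_order_on_def preorder_on_def)
  obtain i\<^sub>0 where i\<^sub>0: "i\<^sub>0 \<in> I" "u i\<^sub>0 x < u i\<^sub>0 y"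
    using assms(4-6) mu[of y x] by (auto simp: incomparable_def not_le)
  obtain q\<^sub>0 where q\<^sub>0: "q\<^sub>0 \<in> \<rat>" "u i\<^sub>0 x < q\<^sub>0" "q\<^sub>0 < u i\<^sub>0 y"
    using Rats_dense_in_real i\<^sub>0(2) by blast
  define up where "up = (\<lambda>(i, q). {z. q < u i z})"
  \<comment> \<open>The separating set is put in front as leading digit. It recurs later in the
    enumeration, which is harmless.\<close>
  define A where "A = case_nat (up (i\<^sub>0, q\<^sub>0)) (\<lambda>n. up (from_nat_into (I \<times> \<rat>) n))"
  \<comment> \<open>\<open>from_nat_into\<close> is sure to land in the set only if the set is
    nonempty.\<close>
  have ne: "I \<times> (\<rat> :: real set) \<noteq> {}"
    using i\<^sub>0(1) q\<^sub>0(1) by blast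
  have A_mono: "b \<in> A k" if "(a, b) \<in> r" "a \<in> A k" for a b k
  proof -
    obtain i q where "i \<in> I" "A k = up (i, q)"
      using i\<^sub>0(1) from_nat_into[OF ne]
      by (cases k) (auto simp: A_def, metis mem_Sigma_iff prod.exhaust)
    moreover from this have "u i a \<le> u i b"
      using that(1) mu[of a b] r_sub by blast
    ultimately show ?thesis
      using that(2) by (simp add: up_def)
  qed
  have A_separates: "(a, b) \<in> r" if "a \<in> X" "b \<in> X" and sub: "\<And>k. a \<in> A k \<Longrightarrow> b \<in> A k" for a b
  proof (rule ccontr)
    assume "(a, b) \<notin> r"
    then obtain i where i: "i \<in> I" "u i b < u i a"
      using mu[OF \<open>a \<in> X\<close> \<open>b \<in> X\<close>] by (auto simp: not_le)
    obtain q where q: "q \<in> \<rat>" "u i b < q" "q < u i a"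
      using Rats_dense_in_real i(2) by blast
    obtain n where "from_nat_into (I \<times> \<rat>) n = (i, q)"
      using from_nat_into_surj[of "I \<times> \<rat>" "(i, q)"] i(1) q(1) assms(2) countable_rat by blast
    then show False
      using sub[of "Suc n"] q by (simp add: A_def up_def)
  qed
  define f where "f = ternary_code A"
  \<comment> \<open>Equal codes mean membership in the same sets, so \<open>A_separates\<close>
    applies in both directions.\<close>
  have "inj_on f X"
  proof (rule inj_onI)
    fix a b assume "a \<in> X" "b \<in> X" "f a = f b"
    then have "(a, b) \<in> r" "(b, a) \<in> r"
      using A_separates ternary_code_inject[of A a b] by (auto simp: f_def)
    with \<open>antisym r\<close> show "a = b"
      by (rule antisymD)
  qed
  define s where "s = {(a, b). a \<in> X \<and> b \<in> X \<and> f a \<le> f b}"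
  have "r \<subseteq> s"
    using r_sub A_mono ternary_code_mono[of _ A] by (fastforce simp: s_def f_def)
  then have "is_extension X r s"
    using partial_order_on_injective_utility[OF \<open>inj_on f X\<close>] by (simp add: is_extension_def s_def)
  moreover have "debreu_separable X s"
    unfolding s_def by (rule debreu_separable_utility)
  moreover have "f x < f y"
    \<comment> \<open>At index 0 there are no earlier digits to compare.\<close>
    unfolding f_def using q\<^sub>0 by (intro ternary_code_less[of 0]) (auto simp: A_def up_def)
  then have "(x, y) \<in> s"
    using assms(4,5) by (simp add: s_def)
  ultimately show ?thesis
    by (intro exI[of _ "\<lambda>_. s"]) (simp add: lim_rel_const)
qed

end
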